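(* For every pair $(A,B) \in \{(36,30), (72,42), (196,70), (252,114)\}$ and every integer $n \geq 0$, we have $\nu_3(An+B) \equiv 0 \pmod{2}$.
   Context: For a positive integer $m$ and $k \geq 1$, $\nu_k(m)$ denotes the number of partitions of $m$ in which exactly $k$ distinct part sizes appear. *)

theory Defs
  imports "HOL-Library.Multiset" "HOL-Number_Theory.Cong"
begin

definition int_partitions :: "nat \<Rightarrow> nat multiset set" where
  "int_partitions m = {P. 0 \<notin># P \<and> sum_mset P = m}"

definition nu :: "nat \<Rightarrow> nat \<Rightarrow> nat" where
  "nu k m = card {P \<in> int_partitions m. card (set_mset P) = k}"

text \<open>There are only finitely many partitions, so the cardinality in \<^const>\<open>nu\<close> is a genuine count.\<close>

lemma finite_int_partitions: "finite (int_partitions m)"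
proof (rule finite_subset)
  show "int_partitions m \<subseteq> mset ` {xs. set xs \<subseteq> {..m} \<and> length xs \<le> m}"
  proof
    fix P assume "P \<in> int_partitions m"
    hence P: "0 \<notin># P" "sum_mset P = m" by (auto simp: int_partitions_def)
    have le: "x \<le> m" if "x \<in># P" for x
      using that P(2) by (metis le_add1 multi_member_split sum_mset.add_mset)
    have "0 \<notin># Q \<Longrightarrow> size Q \<le> sum_mset Q" for Q :: "nat multiset"
      by (induction Q) auto
    hence sz: "size P \<le> m" using P by blast
    obtain xs where "mset xs = P" using ex_mset by blast
    thus "P \<in> mset ` {xs. set xs \<subseteq> {..m} \<and> length xs \<le> m}"
      using le sz by (intro image_eqI[of _ _ xs]) auto
  qed
  show "finite (mset ` {xs. set xs \<subseteq> {..m} \<and> length xs \<le> m})"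
    by (intro finite_imageI finite_lists_length_le) simp
qed

end

theory Submission
  imports
    Defs
    "HOL-Library.Disjoint_Sets"
    "HOL-Library.Z2"
    "HOL-Computational_Algebra.Nth_Powers"
    "HOL-Number_Theory.Residues"
begin

text \<open>
  Everything is counted modulo 2 by involutions. Let \<open>N \<equiv> 2 (mod 4)\<close> not be a sum of two positive
  squares. Marking one of the three part sizes writes a partition as a partition \<open>Q\<close> with two part
  sizes together with a block \<open>z\<^sup>c\<close>, \<open>z \<notin> Q\<close>, so \<open>3 \<nu>\<^sub>3(N)\<close> is the number of all pairs \<open>(Q, z\<^sup>c)\<close> of
  total \<open>N\<close> minus the number of those with \<open>z \<in> Q\<close>.

  In the set of all pairs, transposing the block \<open>z\<^sup>c\<close> leaves the sum of \<open>\<nu>\<^sub>2(N - s\<^sup>2)\<close> over \<open>s\<close>. By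
  conjugation, \<open>\<nu>\<^sub>2(n)\<close> has the parity of the number of solutions of \<open>x\<^sup>2 + 2 x d = n\<close>, and these are
  for \<open>n = N - s\<^sup>2\<close>, where \<open>d\<close> must be even, the fixed points of Zagier's involution on the windmills
  \<open>u\<^sup>2 + 4 y z = n\<close>. The involution is defined everywhere because \<open>n\<close> is neither a square nor divisible
  by 4; transposing \<open>y, z\<close> instead leaves \<open>u\<^sup>2 + 4 y\<^sup>2 = n\<close>.
  Finally, transposing \<open>s, u\<close> leaves the solutions of \<open>2 s\<^sup>2 + 4 y\<^sup>2 = N\<close>.

  In the pairs with \<open>z \<in> Q\<close>, exchanging the two blocks of \<open>z\<close> leaves the pairs of a block \<open>y\<^sup>b\<close> and a
  doubled block \<open>z\<^bsup>2c\<^esup>\<close> with \<open>z \<noteq> y\<close>. Without the condition \<open>z \<noteq> y\<close> these would leave the sum of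
  \<open>\<nu>\<^sub>1(N - 2 s\<^sup>2)\<close>, hence the solutions of \<open>2 s\<^sup>2 + t\<^sup>2 = N\<close>, which cancel against those of
  \<open>2 s\<^sup>2 + 4 y\<^sup>2 = N\<close>. What remains is \<open>z (b + 2 c) = N\<close>, that is, the sum of \<open>(d - 1) div 2\<close> over the
  divisors \<open>d\<close> of \<open>N\<close>, which has the parity of the number of divisors \<open>d \<equiv> 3 (mod 4)\<close>.

  If \<open>N = 2 p m\<close> with a prime \<open>p \<equiv> 3 (mod 4)\<close> and \<open>m\<close> odd and prime to \<open>p\<close>, these divisors correspond
  to the divisors of \<open>m\<close>, whose number is even unless \<open>m\<close> is a square. The four progressions are of
  this form with \<open>p = 3\<close> or \<open>p = 7\<close>.
\<close>

subsection \<open>Parity of cardinalities\<close>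

lemma even_card_involution:
  assumes "finite A"
    and maps: "\<And>x. x \<in> A \<Longrightarrow> f x \<in> A" and invol: "\<And>x. x \<in> A \<Longrightarrow> f (f x) = x"
  shows "even (card A) \<longleftrightarrow> even (card {x \<in> A. f x = x})"
proof -
  let ?moved = "{x \<in> A. f x \<noteq> x}"
  have "(\<Sum>x\<in>?moved. 1 :: bit) = 0"
    by (rule sum_involution_eq_0[where h = f]) (auto simp: maps invol)
  then have "even (card ?moved)"
    by (simp only: sum_constant mult_1_right flip: even_of_nat[where 'a = bit]) simp
  moreover have "card A = card {x \<in> A. f x = x} + card ?moved"
    using \<open>finite A\<close> by (subst card_Un_disjoint[symmetric]) (auto intro: arg_cong[where f = card])
  ultimately show ?thesis by simp
qed

lemma even_card_involution_byWitness:
  assumes "finite A" "\<And>x. x \<in> A \<Longrightarrow> f x \<in> A" "\<And>x. x \<in> A \<Longrightarrow> f (f x) = x"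
    and "\<And>y. y \<in> B \<Longrightarrow> g y \<in> A" "\<And>y. y \<in> B \<Longrightarrow> f (g y) = g y" "\<And>y. y \<in> B \<Longrightarrow> h (g y) = y"
    and "\<And>x. x \<in> A \<Longrightarrow> f x = x \<Longrightarrow> h x \<in> B" "\<And>x. x \<in> A \<Longrightarrow> f x = x \<Longrightarrow> g (h x) = x"
  shows "even (card A) \<longleftrightarrow> even (card B)"
proof -
  have "bij_betw g B {x \<in> A. f x = x}"
    using assms(4-) by (intro bij_betw_byWitness[where f' = h]) auto
  then show ?thesis
    using even_card_involution[of A f] assms(1-3) by (simp add: bij_betw_same_card)
qed

lemma even_card_Sigma_cong:
  assumes "finite A" "\<And>x. x \<in> A \<Longrightarrow> finite (B x)" "\<And>x. x \<in> A \<Longrightarrow> finite (C x)"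
    and "\<And>x. x \<in> A \<Longrightarrow> even (card (B x)) \<longleftrightarrow> even (card (C x))"
  shows "even (card (Sigma A B)) \<longleftrightarrow> even (card (Sigma A C))"
proof -
  have "{x \<in> A. odd (card (B x))} = {x \<in> A. odd (card (C x))}" using assms(4) by blast
  then show ?thesis using assms(1-3) by (simp add: even_sum_iff)
qed

subsection \<open>Squares and divisors\<close>

lemma finite_mult_square_le:
  fixes m n :: nat
  assumes "0 < m"
  shows "finite {s. m * s\<^sup>2 \<le> n}"
proof (rule finite_subset)
  have "s \<le> m * s\<^sup>2" for s using assms by (simp add: power2_eq_square)
  then show "{s. m * s\<^sup>2 \<le> n} \<subseteq> {..n}" using le_trans by blast
qed simp

lemma square_mod_4: "x\<^sup>2 mod 4 = 0 \<or> x\<^sup>2 mod 4 = (1 :: nat)"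
proof (cases "even x")
  case True
  then show ?thesis by (auto elim!: evenE simp: power_mult_distrib)
next
  case False
  then obtain i where "x = 2 * i + 1" by (rule oddE)
  then have "x\<^sup>2 = 4 * (i\<^sup>2 + i) + 1" by (simp add: power2_eq_square)
  then obtain j where "x\<^sup>2 = 4 * j + 1" by blast
  then show ?thesis by simp
qed

lemma square_add_double_mult_mod_4:
  fixes x d :: nat
  assumes "odd d"
  shows "(x\<^sup>2 + 2 * (x * d)) mod 4 = 0 \<or> (x\<^sup>2 + 2 * (x * d)) mod 4 = 3"
proof (cases "even x")
  case True
  then obtain i where "x = 2 * i" by (rule evenE)
  then have "x\<^sup>2 + 2 * (x * d) = 4 * (i\<^sup>2 + i * d)" by (simp add: power2_eq_square algebra_simps)
  then show ?thesis by simp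
next
  case False
  then obtain i where "x = 2 * i + 1" by (rule oddE)
  moreover obtain e where "d = 2 * e + 1" using \<open>odd d\<close> by (rule oddE)
  ultimately have "x\<^sup>2 + 2 * (x * d) = 4 * (i\<^sup>2 + 2 * (i * e) + 2 * i + e) + 3"
    by (simp add: power2_eq_square algebra_simps)
  then obtain j where "x\<^sup>2 + 2 * (x * d) = 4 * j + 3" by blast
  then show ?thesis by simp
qed

lemma not_is_square_if_residue:
  fixes m :: nat
  assumes "m mod 3 = 2 \<or> m mod 4 = 3 \<or> m mod 7 = 5"
  shows "\<not> is_square m"
proof
  assume "is_square m"
  then obtain k where m_eq: "m = k\<^sup>2" by (rule is_nth_powerE)
  have "k mod 3 \<in> {0, 1, 2}" by auto
  then have "(k mod 3)\<^sup>2 mod 3 \<noteq> 2" by auto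
  moreover have "k mod 7 \<in> {0, 1, 2, 3, 4, 5, 6}" by auto
  then have "(k mod 7)\<^sup>2 mod 7 \<noteq> 5" by auto
  ultimately show False using assms square_mod_4[of k] by (auto simp: m_eq power_mod)
qed

lemma prime_3_mod_4_dvd_sum_squares:
  fixes p a b :: nat
  assumes "prime p" "p mod 4 = 3" and dvd: "p dvd a\<^sup>2 + b\<^sup>2"
  shows "p dvd a"
proof (rule ccontr)
  assume "\<not> p dvd a"
  then have "\<not> p dvd b"
    using dvd \<open>prime p\<close> by (metis dvd_add_left_iff pos2 prime_dvd_power_iff)
  obtain k where half: "odd k" "p - 1 = 2 * k"
  proof
    show "odd ((p - 1) div 2)" "p - 1 = 2 * ((p - 1) div 2)" using assms(2) by presburger+
  qed
  have "[int a ^ 2 = - (int b ^ 2)] (mod int p)"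
    using dvd by (simp add: cong_iff_dvd_diff flip: of_nat_power of_nat_add)
  then have "[(int a ^ 2) ^ k = (- (int b ^ 2)) ^ k] (mod int p)" by (rule cong_pow)
  then have "[int (a ^ (p - 1)) = - int (b ^ (p - 1))] (mod int p)"
    using half by (simp add: power_mult)
  moreover have "[int (a ^ (p - 1)) = int 1] (mod int p)" "[int (b ^ (p - 1)) = int 1] (mod int p)"
    using fermat_theorem[OF \<open>prime p\<close>] \<open>\<not> p dvd a\<close> \<open>\<not> p dvd b\<close> cong_int_iff by blast+
  ultimately have "[1 = - 1] (mod int p)"
    by (metis cong_minus_minus_iff cong_sym cong_trans of_nat_1)
  then have "p dvd 2" by (simp add: cong_iff_dvd_diff) presburger
  then show False using assms(2) by (auto dest!: dvd_imp_le simp: le_Suc_eq numeral_2_eq_2)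
qed

lemma sum_squares_ne_prime_mult:
  fixes p n a b :: nat
  assumes "prime p" "p mod 4 = 3" "\<not> p dvd n"
  shows "a\<^sup>2 + b\<^sup>2 \<noteq> p * n"
proof
  assume eq: "a\<^sup>2 + b\<^sup>2 = p * n"
  then have "p dvd a\<^sup>2 + b\<^sup>2" "p dvd b\<^sup>2 + a\<^sup>2" by (simp_all add: add.commute)
  then have "p dvd a" "p dvd b" using prime_3_mod_4_dvd_sum_squares assms(1,2) by blast+
  then have "p * p dvd p * n"
    unfolding eq[symmetric] power2_eq_square by (intro dvd_add mult_dvd_mono)
  then show False using assms(1,3) by (simp add: prime_gt_0_nat)
qed

lemma even_card_divisors_iff:
  fixes n :: nat
  assumes "0 < n"
  shows "even (card {d. d dvd n}) \<longleftrightarrow> even (card {d. d\<^sup>2 = n})"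
proof -
  have "even (card {d. d dvd n}) \<longleftrightarrow> even (card {d \<in> {d. d dvd n}. n div d = d})"
    using assms by (intro even_card_involution) (auto elim!: dvdE)
  also have "{d \<in> {d. d dvd n}. n div d = d} = {d. d\<^sup>2 = n}"
    using assms by (auto simp: power2_eq_square)
  finally show ?thesis .
qed

lemma even_sum_half_divisors_iff:
  fixes n :: nat
  assumes "\<not> 4 dvd n"
  shows "even (\<Sum>d | d dvd n. (d - 1) div 2) \<longleftrightarrow> even (card {d. d dvd n \<and> d mod 4 = 3})"
proof -
  have "odd ((d - 1) div 2) \<longleftrightarrow> d mod 4 = 3" if "d dvd n" for d :: nat
  proof -
    have "\<not> 4 dvd d" using that assms dvd_trans by blast
    then show ?thesis by presburger
  qed
  then have "{d \<in> {d. d dvd n}. odd ((d - 1) div 2)} = {d. d dvd n \<and> d mod 4 = 3}" by blast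
  moreover have "finite {d. d dvd n}" using assms by (intro finite_divisors_nat) (auto intro: gr0I)
  ultimately show ?thesis by (simp only: even_sum_iff)
qed

lemma divisors_prime_mult:
  fixes p n :: nat
  assumes "prime p"
  shows "{d. d dvd p * n} = {d. d dvd n} \<union> (*) p ` {d. d dvd n}"
proof (intro equalityI subsetI)
  fix d assume "d \<in> {d. d dvd p * n}"
  then have dvd: "d dvd p * n" by simp
  show "d \<in> {d. d dvd n} \<union> (*) p ` {d. d dvd n}"
  proof (cases "p dvd d")
    case True
    then show ?thesis using dvd \<open>prime p\<close> by (auto elim!: dvdE[of p d])
  next
    case False
    then have "coprime d p" using \<open>prime p\<close> prime_imp_coprime coprime_commute by blast
    then show ?thesis using dvd by (simp add: coprime_dvd_mult_right_iff)
  qed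
qed auto

lemma card_divisors_3_mod_4:
  fixes p n :: nat
  assumes "prime p" "p mod 4 = 3" "\<not> p dvd n"
  shows "card {d. d dvd p * n \<and> d mod 4 = 3} = card {d. d dvd n \<and> odd d}"
proof -
  have "0 < n" "0 < p" using assms by (auto intro: gr0I)
  have mult_mod_4: "p * d mod 4 = 3 \<longleftrightarrow> d mod 4 = 1" for d
  proof -
    have "p * d mod 4 = 3 * d mod 4" using assms(2) by (metis mod_mult_left_eq)
    moreover have "3 * d mod 4 = 3 \<longleftrightarrow> d mod 4 = 1" by presburger
    ultimately show ?thesis by simp
  qed
  have "{d. d dvd p * n \<and> d mod 4 = 3} = {d \<in> {d. d dvd p * n}. d mod 4 = 3}" by simp
  also have "\<dots> = {d. d dvd n \<and> d mod 4 = 3} \<union> (*) p ` {d. d dvd n \<and> d mod 4 = 1}"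
    unfolding divisors_prime_mult[OF \<open>prime p\<close>] using mult_mod_4 by auto
  finally have "card {d. d dvd p * n \<and> d mod 4 = 3} =
      card {d. d dvd n \<and> d mod 4 = 3} + card ((*) p ` {d. d dvd n \<and> d mod 4 = 1})"
    using \<open>\<not> p dvd n\<close> \<open>0 < n\<close> by (subst card_Un_disjoint[symmetric]) (auto dest: dvd_mult_left)
  also have "card ((*) p ` {d. d dvd n \<and> d mod 4 = 1}) = card {d. d dvd n \<and> d mod 4 = 1}"
    using \<open>0 < p\<close> by (intro card_image) (simp add: inj_on_def)
  also have "card {d. d dvd n \<and> d mod 4 = 3} + card {d. d dvd n \<and> d mod 4 = 1} =
      card ({d. d dvd n \<and> d mod 4 = 3} \<union> {d. d dvd n \<and> d mod 4 = 1})"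
    using \<open>0 < n\<close> by (intro card_Un_disjoint[symmetric]) auto
  also have "{d. d dvd n \<and> d mod 4 = 3} \<union> {d. d dvd n \<and> d mod 4 = 1} = {d. d dvd n \<and> odd d}"
  proof -
    have "d mod 4 = 3 \<or> d mod 4 = 1 \<longleftrightarrow> odd d" for d :: nat by presburger
    then show ?thesis by blast
  qed
  finally show ?thesis .
qed

definition diagonal_form_reps :: "nat \<Rightarrow> nat \<Rightarrow> nat \<Rightarrow> (nat \<times> nat) set" where
  "diagonal_form_reps a b n = {(s, t). 0 < s \<and> 0 < t \<and> a * s\<^sup>2 + b * t\<^sup>2 = n}"

lemma finite_diagonal_form_reps:
  assumes "0 < a" "0 < b"
  shows "finite (diagonal_form_reps a b n)"
proof (rule finite_subset)
  show "diagonal_form_reps a b n \<subseteq> {s. a * s\<^sup>2 \<le> n} \<times> {t. b * t\<^sup>2 \<le> n}"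
    by (auto simp: diagonal_form_reps_def)
qed (use assms in \<open>simp add: finite_mult_square_le\<close>)

lemma card_diagonal_form_reps_4_eq_1:
  assumes "even a" "even n"
  shows "card (diagonal_form_reps a 4 n) = card (diagonal_form_reps a 1 n)"
proof (rule bij_betw_same_card)
  have "diagonal_form_reps a 1 n = {(s, t) \<in> diagonal_form_reps a 1 n. even t}"
    using assms by (auto simp: diagonal_form_reps_def)
  moreover have "bij_betw (\<lambda>(s, t). (s, 2 * t)) (diagonal_form_reps a 4 n)
      {(s, t) \<in> diagonal_form_reps a 1 n. even t}"
    by (rule bij_betw_byWitness[where f' = "\<lambda>(s, t). (s, t div 2)"])
      (auto simp: diagonal_form_reps_def power2_eq_square elim!: evenE)
  ultimately show "bij_betw (\<lambda>(s, t). (s, 2 * t)) (diagonal_form_reps a 4 n)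
      (diagonal_form_reps a 1 n)" by simp
qed

subsection \<open>Partitions with one or two part sizes\<close>

lemma filter_neq_add_replicate_count:
  "{#x \<in># P. x \<noteq> z#} + replicate_mset (count P z) z = P"
  by (rule multiset_eqI) auto

lemma sum_mset_filter_neq:
  fixes P :: "nat multiset"
  shows "sum_mset {#x \<in># P. x \<noteq> z#} + z * count P z = sum_mset P"
  using arg_cong[OF filter_neq_add_replicate_count[of z P], of sum_mset] by (simp add: mult.commute)

lemma set_mset_filter_neq: "set_mset {#x \<in># P. x \<noteq> z#} = set_mset P - {z}"
  by auto

lemma filter_neq_ident: "z \<notin># P \<Longrightarrow> {#x \<in># P. x \<noteq> z#} = P"
  by (rule multiset_eqI) (auto simp: not_in_iff)

lemma filter_neq_replicate_mset: "{#x \<in># replicate_mset c z. x \<noteq> z#} = {#}"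
  by (rule multiset_eqI) simp

lemma set_mset_eq_singletonD: "set_mset P = {x} \<Longrightarrow> P = replicate_mset (count P x) x"
  by (rule multiset_eqI) (auto simp: count_eq_zero_iff)

lemma set_mset_eq_doubletonD:
  "set_mset P = {x, y} \<Longrightarrow> x \<noteq> y \<Longrightarrow>
    P = replicate_mset (count P x) x + replicate_mset (count P y) y"
  by (rule multiset_eqI) (auto simp: count_eq_zero_iff)

definition partitions_with_sizes :: "nat \<Rightarrow> nat \<Rightarrow> nat multiset set" where
  "partitions_with_sizes k n = {P \<in> int_partitions n. card (set_mset P) = k}"

lemma nu_eq_card: "nu k n = card (partitions_with_sizes k n)"
  by (simp add: nu_def partitions_with_sizes_def)

lemma finite_partitions_with_sizes: "finite (partitions_with_sizes k n)"
  by (simp add: partitions_with_sizes_def finite_int_partitions)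

lemma nu_1_eq_card_divisors:
  assumes "0 < n"
  shows "nu 1 n = card {d. d dvd n}"
proof -
  let ?f = "\<lambda>d. replicate_mset (n div d) d"
  have "partitions_with_sizes 1 n = ?f ` {d. d dvd n}"
  proof (intro equalityI subsetI)
    fix P assume "P \<in> partitions_with_sizes 1 n"
    then obtain d where "set_mset P = {d}" and sum: "sum_mset P = n" and "0 \<notin># P"
      by (auto simp: partitions_with_sizes_def int_partitions_def card_1_singleton_iff)
    then have P_eq: "P = replicate_mset (count P d) d" and "0 < d"
      by (auto dest: set_mset_eq_singletonD intro: gr0I)
    have "n = count P d * d" using sum by (subst (asm) P_eq) simp
    then show "P \<in> ?f ` {d. d dvd n}"
      using P_eq \<open>0 < d\<close> by (intro image_eqI[of _ _ d]) auto
  qed (use assms in \<open>auto simp: partitions_with_sizes_def int_partitions_def\<close>)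
  moreover have "inj_on ?f {d. d dvd n}"
    using assms
    by (auto simp: inj_on_def elim!: dvdE dest!: arg_cong[where f = set_mset] split: if_splits)
  ultimately show ?thesis by (simp add: nu_eq_card card_image)
qed

lemma even_nu_1_iff: "even (nu 1 n) \<longleftrightarrow> even (card {t. 0 < t \<and> t\<^sup>2 = n})"
proof (cases "n = 0")
  case True
  have "partitions_with_sizes 1 0 = {}"
    by (auto simp: partitions_with_sizes_def int_partitions_def card_1_singleton_iff)
  then show ?thesis using True by (simp add: nu_eq_card conj_commute cong: conj_cong)
next
  case False
  then have "{t. 0 < t \<and> t\<^sup>2 = n} = {t. t\<^sup>2 = n}" by (auto intro: gr0I)
  then show ?thesis using even_card_divisors_iff[of n] nu_1_eq_card_divisors[of n] False by simp
qed

text \<open>The tuple \<open>(x, a, y, b)\<close> encodes the partition \<open>x\<^sup>a y\<^sup>b\<close>.\<close>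

definition two_size_partitions :: "nat \<Rightarrow> (nat \<times> nat \<times> nat \<times> nat) set" where
  "two_size_partitions n =
     {(x, a, y, b). 0 < x \<and> 0 < a \<and> x < y \<and> 0 < b \<and> x * a + y * b = n}"

lemma bij_betw_two_size_partitions:
  "bij_betw (\<lambda>(x, a, y, b). replicate_mset a x + replicate_mset b y)
    (two_size_partitions n) (partitions_with_sizes 2 n)"
    (is "bij_betw ?f ?A ?P")
proof (rule bij_betw_imageI)
  show "inj_on ?f ?A"
    by (rule inj_on_inverseI[where g = "\<lambda>P. (Min_mset P, count P (Min_mset P),
          Max_mset P, count P (Max_mset P))"])
      (auto simp: two_size_partitions_def)
  show "?f ` ?A = ?P"
  proof (intro equalityI subsetI)
    fix P assume "P \<in> ?P"
    then have "0 \<notin># P" "sum_mset P = n" "card (set_mset P) = 2"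
      by (auto simp: partitions_with_sizes_def int_partitions_def)
    obtain x y where xy: "set_mset P = {x, y}" "x < y"
      using \<open>card (set_mset P) = 2\<close> by (metis card_2_iff insert_commute linorder_neqE_nat)
    then have P_eq: "P = ?f (x, count P x, y, count P y)"
      using set_mset_eq_doubletonD[of P x y] by simp
    have "x * count P x + y * count P y = n"
      using arg_cong[OF P_eq, of sum_mset] \<open>sum_mset P = n\<close> by (simp add: mult.commute)
    then have "(x, count P x, y, count P y) \<in> ?A"
      using xy \<open>0 \<notin># P\<close> by (auto simp: two_size_partitions_def intro: gr0I)
    then show "P \<in> ?f ` ?A" using P_eq by (rule rev_image_eqI)
  qed (auto simp: two_size_partitions_def partitions_with_sizes_def int_partitions_def mult.commute)
qed

lemma even_nu_2_iff_conjugation: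
  "even (nu 2 n) \<longleftrightarrow> even (card {(x, d). 0 < x \<and> 0 < d \<and> x\<^sup>2 + 2 * (x * d) = n})"
proof -
  let ?A = "two_size_partitions n" and ?B = "{(x, d). 0 < x \<and> 0 < d \<and> x\<^sup>2 + 2 * (x * d) = n}"
  \<comment> \<open>the conjugate of \<open>x\<^sup>a y\<^sup>b\<close> is \<open>b\<^bsup>y - x\<^esup> (a + b)\<^sup>x\<close>\<close>
  let ?conjugate = "\<lambda>(x, a, y, b). (b, y - x, a + b, x)"
  have "even (card ?A) \<longleftrightarrow> even (card ?B)"
  proof (rule even_card_involution_byWitness[where f = ?conjugate
        and g = "\<lambda>(x, d). (x, d, x + d, x)" and h = "\<lambda>(x, a, _). (x, a)"])
    show "finite ?A"
      using bij_betw_two_size_partitions bij_betw_finite finite_partitions_with_sizes by blast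
    show "?conjugate p \<in> ?A" if "p \<in> ?A" for p
    proof -
      obtain x a y b where p_eq: "p = (x, a, y, b)" by (cases p)
      then have "x < y" using that by (simp add: two_size_partitions_def)
      then obtain k where "y = x + k" "0 < k" using less_imp_add_positive by metis
      then show ?thesis using that p_eq
        by (simp add: two_size_partitions_def add_mult_distrib add_mult_distrib2 ac_simps)
    qed
    show "(\<lambda>(x, a, _). (x, a)) p \<in> ?B" if "p \<in> ?A" "?conjugate p = p" for p
    proof -
      obtain x a y b where p_eq: "p = (x, a, y, b)" by (cases p)
      have "b = x" "a + b = y" using that(2) unfolding p_eq prod.case prod.inject by blast+
      then show ?thesis using that(1) p_eq
        by (auto simp: two_size_partitions_def add_mult_distrib power2_eq_square)
    qed
  qed (auto simp: two_size_partitions_def add_mult_distrib power2_eq_square)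
  then show ?thesis
    using bij_betw_same_card[OF bij_betw_two_size_partitions] by (simp add: nu_eq_card)
qed

subsection \<open>Windmills\<close>

definition windmills :: "nat \<Rightarrow> (nat \<times> nat \<times> nat) set" where
  "windmills n = {(u, y, z). 0 < u \<and> 0 < y \<and> 0 < z \<and> u\<^sup>2 + 4 * (y * z) = n}"

lemma finite_windmills: "finite (windmills n)"
proof (rule finite_subset)
  show "windmills n \<subseteq> {..n} \<times> {..n} \<times> {..n}"
  proof
    fix p assume "p \<in> windmills n"
    then obtain u y z where p_eq: "p = (u, y, z)" and "0 < y" "0 < z" "u\<^sup>2 + 4 * (y * z) = n"
      by (auto simp: windmills_def)
    moreover have "u \<le> u\<^sup>2" "y \<le> y * z" "z \<le> y * z"
      using \<open>0 < y\<close> \<open>0 < z\<close> by (simp_all add: power2_eq_square)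
    ultimately have "u \<le> n" "y \<le> n" "z \<le> n" by linarith+
    then show "p \<in> {..n} \<times> {..n} \<times> {..n}" by (simp add: p_eq)
  qed
qed simp

lemma even_card_windmills_swap:
  "even (card (windmills n)) \<longleftrightarrow> even (card (diagonal_form_reps 1 4 n))"
  by (rule even_card_involution_byWitness[where f = "\<lambda>(u, y, z). (u, z, y)"
        and g = "\<lambda>(u, y). (u, y, y)" and h = "\<lambda>(u, y, _). (u, y)"])
    (use finite_windmills in \<open>auto simp: windmills_def diagonal_form_reps_def power2_eq_square
      mult.commute\<close>)

definition zagier :: "nat \<times> nat \<times> nat \<Rightarrow> nat \<times> nat \<times> nat" where
  "zagier = (\<lambda>(u, y, z).
     if u + z < y then (u + 2 * z, z, y - u - z)
     else if u < 2 * y then (2 * y - u, y, u + z - y)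
     else (u - 2 * y, u + z - y, y))"

lemma zagier_windmill_cases:
  assumes "\<not> 4 dvd n" "\<not> is_square n" and w: "(u, y, z) \<in> windmills n"
  obtains (small) "u + z < y" | (middle) "y < u + z" "u < 2 * y" | (large) "2 * y < u"
proof -
  have eq: "u\<^sup>2 + 4 * (y * z) = n" using w by (simp add: windmills_def)
  have "u + z \<noteq> y"
  proof
    assume "u + z = y"
    then have "n = (y + z)\<^sup>2" using eq by (auto simp: power2_eq_square algebra_simps)
    then show False using \<open>\<not> is_square n\<close> by simp
  qed
  moreover have "u \<noteq> 2 * y" using eq \<open>\<not> 4 dvd n\<close> by (auto simp: power_mult_distrib)
  ultimately show thesis using that by linarith
qed

lemma zagier_involution:
  assumes "\<not> 4 dvd n" "\<not> is_square n" and w: "w \<in> windmills n"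
  shows "zagier w \<in> windmills n \<and> zagier (zagier w) = w"
proof -
  obtain u y z where w_eq: "w = (u, y, z)" by (cases w)
  have pos: "0 < u" "0 < y" "0 < z" and eq: "u\<^sup>2 + 4 * (y * z) = n"
    using w by (auto simp: w_eq windmills_def)
  from assms(1,2) w[unfolded w_eq] show ?thesis
  proof (cases rule: zagier_windmill_cases)
    case small
    then obtain k where "y = u + z + k" "0 < k" by (auto dest: less_imp_add_positive)
    then show ?thesis
      using pos eq by (auto simp: w_eq windmills_def zagier_def power2_eq_square algebra_simps)
  next
    case middle
    obtain k where add_eq: "u + z = y + k" "0 < k"
      using less_imp_add_positive[OF middle(1)] by metis
    obtain v where double_eq: "2 * y = u + v" "0 < v"
      using less_imp_add_positive[OF middle(2)] by metis
    have z_int: "int z = int y + int k - int u" and v_int: "int v = 2 * int y - int u"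
      using add_eq double_eq by linarith+
    have "int (v\<^sup>2 + 4 * (y * k)) = int (u\<^sup>2 + 4 * (y * z))"
      by (simp add: z_int v_int power2_eq_square algebra_simps)
    then have "v\<^sup>2 + 4 * (y * k) = n" using eq by linarith
    moreover have "zagier (u, y, z) = (v, y, k)"
      using middle add_eq double_eq by (simp add: zagier_def)
    moreover have "zagier (v, y, k) = (u, y, z)"
      using middle add_eq double_eq pos by (auto simp: zagier_def)
    ultimately show ?thesis using pos add_eq double_eq by (simp add: w_eq windmills_def)
  next
    case large
    then obtain k where "u = 2 * y + k" "0 < k" by (auto dest: less_imp_add_positive)
    then show ?thesis
      using pos eq by (auto simp: w_eq windmills_def zagier_def power2_eq_square algebra_simps)
  qed
qed

lemma even_card_windmills_zagier:
  assumes "\<not> 4 dvd n" "\<not> is_square n"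
  shows "even (card (windmills n)) \<longleftrightarrow>
    even (card {(x, z). 0 < x \<and> 0 < z \<and> x\<^sup>2 + 4 * (x * z) = n})"
proof (rule even_card_involution_byWitness[where f = zagier and g = "\<lambda>(x, z). (x, x, z)"
      and h = "\<lambda>(u, _, z). (u, z)"])
  show "finite (windmills n)" by (rule finite_windmills)
  show "zagier w \<in> windmills n" "zagier (zagier w) = w" if "w \<in> windmills n" for w
    using zagier_involution[OF assms that] by blast+
qed (auto simp: windmills_def zagier_def split: if_splits)

lemma even_nu_2_iff:
  assumes "n mod 4 = 1 \<or> n mod 4 = 2" "\<not> is_square n"
  shows "even (nu 2 n) \<longleftrightarrow> even (card (diagonal_form_reps 1 4 n))"
proof -
  have "even d" if "x\<^sup>2 + 2 * (x * d) = n" for x d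
  proof (rule ccontr)
    assume "odd d"
    then show False using square_add_double_mult_mod_4[of d x] that assms(1) by auto
  qed
  then have "{(x, d). 0 < x \<and> 0 < d \<and> x\<^sup>2 + 2 * (x * d) = n} =
      {(x, d). 0 < x \<and> 0 < d \<and> x\<^sup>2 + 2 * (x * d) = n \<and> even d}"
    by blast
  moreover have "bij_betw (\<lambda>(x, z). (x, 2 * z)) {(x, z). 0 < x \<and> 0 < z \<and> x\<^sup>2 + 4 * (x * z) = n}
      {(x, d). 0 < x \<and> 0 < d \<and> x\<^sup>2 + 2 * (x * d) = n \<and> even d}"
    by (rule bij_betw_byWitness[where f' = "\<lambda>(x, d). (x, d div 2)"]) (auto elim!: evenE)
  ultimately have "even (nu 2 n) \<longleftrightarrow>
      even (card {(x, z). 0 < x \<and> 0 < z \<and> x\<^sup>2 + 4 * (x * z) = n})"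
    by (simp add: even_nu_2_iff_conjugation bij_betw_same_card)
  also have "\<dots> \<longleftrightarrow> even (card (windmills n))"
    using assms by (intro even_card_windmills_zagier[symmetric]) auto
  finally show ?thesis by (simp only: even_card_windmills_swap)
qed

lemma even_nu_2_diff_square_iff:
  assumes "n mod 4 = 2" and no_sum: "diagonal_form_reps 1 1 n = {}"
    and "0 < s" "s\<^sup>2 \<le> n"
  shows "even (nu 2 (n - s\<^sup>2)) \<longleftrightarrow> even (card (diagonal_form_reps 1 4 (n - s\<^sup>2)))"
proof -
  obtain k where n_eq: "n = s\<^sup>2 + k" using \<open>s\<^sup>2 \<le> n\<close> le_Suc_ex by blast
  have mod_4: "k mod 4 = 1 \<or> k mod 4 = 2"
  proof -
    have "k mod 4 = 1 \<or> k mod 4 = 2" if "(j + k) mod 4 = 2" "j mod 4 = 0 \<or> j mod 4 = 1" for j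
      using that by presburger
    then show ?thesis using \<open>n mod 4 = 2\<close> square_mod_4 unfolding n_eq by blast
  qed
  have "\<not> is_square k"
  proof
    assume "is_square k"
    then obtain u where k_eq: "k = u\<^sup>2" by (rule is_nth_powerE)
    then have "u \<noteq> 0" using mod_4 by (cases "u = 0") auto
    then have "(s, u) \<in> diagonal_form_reps 1 1 n"
      using \<open>0 < s\<close> n_eq k_eq by (simp add: diagonal_form_reps_def)
    then show False using no_sum by simp
  qed
  with mod_4 show ?thesis unfolding n_eq by (simp add: even_nu_2_iff)
qed

subsection \<open>Marked partitions\<close>

text \<open>
  The marked block \<open>z\<^sup>c\<close> is kept apart from \<open>Q\<close>, in which \<open>z\<close> may occur as well, and it is counted
  with weight \<open>m\<close>; the weight 2 arises from merging two equal blocks.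
\<close>

definition marked_partitions :: "nat \<Rightarrow> nat \<Rightarrow> nat \<Rightarrow> (nat multiset \<times> nat \<times> nat) set" where
  "marked_partitions m k n = {(Q, z, c). 0 \<notin># Q \<and> card (set_mset Q) = k \<and> 0 < z \<and> 0 < c \<and>
     sum_mset Q + m * (z * c) = n}"

lemma finite_marked_partitions:
  assumes "0 < m"
  shows "finite (marked_partitions m k n)"
proof (rule finite_subset)
  show "marked_partitions m k n \<subseteq> (\<Union>i\<le>n. int_partitions i) \<times> {..n} \<times> {..n}"
  proof
    fix p assume "p \<in> marked_partitions m k n"
    then obtain Q z c where p_eq: "p = (Q, z, c)" and "0 \<notin># Q" "0 < z" "0 < c"
      and sum: "sum_mset Q + m * (z * c) = n"
      by (cases p) (auto simp: marked_partitions_def)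
    have "z \<le> z * c" "c \<le> z * c" using \<open>0 < z\<close> \<open>0 < c\<close> by simp_all
    moreover have "z * c \<le> m * (z * c)" using \<open>0 < m\<close> by simp
    ultimately have "z \<le> n" "c \<le> n" using sum by linarith+
    then show "p \<in> (\<Union>i\<le>n. int_partitions i) \<times> {..n} \<times> {..n}"
      using p_eq \<open>0 \<notin># Q\<close> sum by (auto simp: int_partitions_def)
  qed
  show "finite ((\<Union>i\<le>n. int_partitions i) \<times> {..n} \<times> {..n})"
    by (simp add: finite_int_partitions)
qed

lemma card_marked_partitions_split:
  assumes "0 < m"
  shows "card (marked_partitions m k n) =
    card {(Q, z, c) \<in> marked_partitions m k n. z \<notin># Q} +
    card {(Q, z, c) \<in> marked_partitions m k n. z \<in># Q}"
  using finite_marked_partitions[OF assms]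
  by (subst card_Un_disjoint[symmetric]) (auto intro: finite_subset arg_cong[where f = card])

lemma card_marked_partitions_fresh:
  "card {(Q, z, c) \<in> marked_partitions 1 k n. z \<notin># Q} = Suc k * nu (Suc k) n"
proof -
  let ?P = "partitions_with_sizes (Suc k) n"
  have "bij_betw (\<lambda>(P, z). ({#x \<in># P. x \<noteq> z#}, z, count P z)) (Sigma ?P set_mset)
      {(Q, z, c) \<in> marked_partitions 1 k n. z \<notin># Q}"
    by (rule bij_betw_byWitness[where f' = "\<lambda>(Q, z, c). (Q + replicate_mset c z, z)"])
      (auto simp: filter_neq_add_replicate_count filter_neq_ident filter_neq_replicate_mset
        sum_mset_filter_neq set_mset_filter_neq partitions_with_sizes_def marked_partitions_def
        int_partitions_def not_in_iff[THEN iffD1] mult.commute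
        simp del: set_mset_filter intro: gr0I)
  then have "card {(Q, z, c) \<in> marked_partitions 1 k n. z \<notin># Q} = card (Sigma ?P set_mset)"
    by (simp add: bij_betw_same_card)
  also have "\<dots> = (\<Sum>P\<in>?P. Suc k)"
    by (simp add: finite_partitions_with_sizes) (simp add: partitions_with_sizes_def)
  finally show ?thesis by (simp add: nu_eq_card mult.commute)
qed

definition exchange_blocks :: "nat multiset \<times> nat \<times> nat \<Rightarrow> nat multiset \<times> nat \<times> nat" where
  "exchange_blocks =
     (\<lambda>(Q, z, c). ({#x \<in># Q. x \<noteq> z#} + replicate_mset c z, z, count Q z))"

lemma exchange_blocks_mem:
  assumes "p \<in> {(Q, z, c) \<in> marked_partitions 1 k n. z \<in># Q}"
  shows "exchange_blocks p \<in> {(Q, z, c) \<in> marked_partitions 1 k n. z \<in># Q}"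
proof -
  obtain Q z c where p_eq: "p = (Q, z, c)" by (cases p)
  then have "z \<in># Q" using assms by simp
  then have "insert z (set_mset Q - {z}) = set_mset Q" by blast
  then show ?thesis
    using assms sum_mset_filter_neq[of z Q]
    by (auto simp: p_eq exchange_blocks_def marked_partitions_def set_mset_filter_neq mult.commute
        simp del: set_mset_filter)
qed

lemma exchange_blocks_exchange_blocks:
  "exchange_blocks (exchange_blocks p) = p"
  by (auto simp: exchange_blocks_def filter_neq_add_replicate_count filter_neq_replicate_mset
      filter_neq_ident split: prod.split)

lemma even_card_marked_partitions_repeated:
  "even (card {(Q, z, c) \<in> marked_partitions 1 (Suc k) n. z \<in># Q}) \<longleftrightarrow>
   even (card {(Q, z, c) \<in> marked_partitions 2 k n. z \<notin># Q})"
    (is "even (card ?A) \<longleftrightarrow> even (card ?B)")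
proof -
  let ?join = "\<lambda>(Q, z, c). (Q + replicate_mset c z, z, c)"
  let ?split = "\<lambda>(Q, z, c). ({#x \<in># Q. x \<noteq> z#}, z, c)"
  show ?thesis
  proof (rule even_card_involution_byWitness[where f = exchange_blocks
        and g = ?join and h = ?split])
    show "finite ?A"
      by (rule finite_subset[OF _ finite_marked_partitions[of 1]]) auto
    show "exchange_blocks p \<in> ?A" if "p \<in> ?A" for p
      using that by (rule exchange_blocks_mem)
    show "exchange_blocks (exchange_blocks p) = p" for p
      by (rule exchange_blocks_exchange_blocks)
    show "?join q \<in> ?A" "exchange_blocks (?join q) = ?join q" "?split (?join q) = q"
      if "q \<in> ?B" for q
      using that by (auto simp: exchange_blocks_def marked_partitions_def filter_neq_ident
          filter_neq_replicate_mset not_in_iff[THEN iffD1] mult.commute)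
    show "?join (?split p) = p" if "p \<in> ?A" "exchange_blocks p = p" for p
      using that by (auto simp: exchange_blocks_def)
    show "?split p \<in> ?B" if "p \<in> ?A" "exchange_blocks p = p" for p
    proof -
      obtain Q z c where p_eq: "p = (Q, z, c)" by (cases p)
      then have "count Q z = c" using that by (simp add: exchange_blocks_def)
      then show ?thesis
        using that(1) sum_mset_filter_neq[of z Q]
        by (auto simp: p_eq marked_partitions_def set_mset_filter_neq simp del: set_mset_filter)
    qed
  qed
qed

lemma even_card_marked_partitions_diagonal:
  assumes "0 < m"
  shows "even (card (marked_partitions m k n)) \<longleftrightarrow>
    even (card (SIGMA s:{s. 0 < s \<and> m * s\<^sup>2 \<le> n}. partitions_with_sizes k (n - m * s\<^sup>2)))"
  by (rule even_card_involution_byWitness[where f = "\<lambda>(Q, z, c). (Q, c, z)"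
        and g = "\<lambda>(s, Q). (Q, s, s)" and h = "\<lambda>(Q, s, _). (s, Q)"])
    (use assms finite_marked_partitions in \<open>auto simp: marked_partitions_def
      partitions_with_sizes_def int_partitions_def power2_eq_square mult.commute\<close>)

lemma even_card_marked_partitions_1_2:
  assumes "n mod 4 = 2" "diagonal_form_reps 1 1 n = {}"
  shows "even (card (marked_partitions 1 2 n)) \<longleftrightarrow> even (card (diagonal_form_reps 2 4 n))"
proof -
  let ?S = "{s. 0 < s \<and> s\<^sup>2 \<le> n}"
  let ?R = "{(s, u, y). 0 < s \<and> 0 < u \<and> 0 < y \<and> s\<^sup>2 + u\<^sup>2 + 4 * y\<^sup>2 = n}"
  have fin: "finite ?S" by (rule finite_subset[OF _ finite_mult_square_le[of 1 n]]) auto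
  have R_eq: "?R = (SIGMA s:?S. diagonal_form_reps 1 4 (n - s\<^sup>2))"
    by (auto simp: diagonal_form_reps_def)
  have "even (card (marked_partitions 1 2 n)) \<longleftrightarrow>
      even (card (SIGMA s:?S. partitions_with_sizes 2 (n - s\<^sup>2)))"
    using even_card_marked_partitions_diagonal[of 1 2 n] by simp
  also have "\<dots> \<longleftrightarrow> even (card (SIGMA s:?S. diagonal_form_reps 1 4 (n - s\<^sup>2)))"
    using fin finite_partitions_with_sizes finite_diagonal_form_reps[of 1 4]
      even_nu_2_diff_square_iff[OF assms]
    by (intro even_card_Sigma_cong) (simp_all flip: nu_eq_card)
  also have "\<dots> \<longleftrightarrow> even (card ?R)" unfolding R_eq ..
  also have "\<dots> \<longleftrightarrow> even (card (diagonal_form_reps 2 4 n))"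
  proof (rule even_card_involution_byWitness[where f = "\<lambda>(s, u, y). (u, s, y)"
        and g = "\<lambda>(s, y). (s, s, y)" and h = "\<lambda>(s, _, y). (s, y)"])
    show "finite ?R" unfolding R_eq using fin by (simp add: finite_diagonal_form_reps)
  qed (auto simp: diagonal_form_reps_def)
  finally show ?thesis .
qed

lemma even_card_marked_partitions_2_1:
  "even (card (marked_partitions 2 1 n)) \<longleftrightarrow> even (card (diagonal_form_reps 2 1 n))"
proof -
  let ?S = "{s. 0 < s \<and> 2 * s\<^sup>2 \<le> n}" and ?T = "\<lambda>k. {t. 0 < t \<and> t\<^sup>2 = k}"
  have fin_S: "finite ?S" by (rule finite_subset[OF _ finite_mult_square_le[of 2 n]]) auto
  have fin_T: "finite (?T k)" for k :: nat
    by (rule finite_subset[OF _ finite_mult_square_le[of 1 k]]) auto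
  have "even (card (marked_partitions 2 1 n)) \<longleftrightarrow>
      even (card (SIGMA s:?S. partitions_with_sizes 1 (n - 2 * s\<^sup>2)))"
    using even_card_marked_partitions_diagonal[of 2 1 n] by simp
  also have "\<dots> \<longleftrightarrow> even (card (SIGMA s:?S. ?T (n - 2 * s\<^sup>2)))"
    using fin_S fin_T finite_partitions_with_sizes even_nu_1_iff
    by (intro even_card_Sigma_cong) (simp_all only: nu_eq_card)
  also have "(SIGMA s:?S. ?T (n - 2 * s\<^sup>2)) = diagonal_form_reps 2 1 n"
    by (auto simp: diagonal_form_reps_def)
  finally show ?thesis .
qed

lemma marked_partitions_2_1_repeated_eq:
  "{(Q, z, c) \<in> marked_partitions 2 1 n. z \<in># Q} =
    (\<lambda>(z, b, c). (replicate_mset b z, z, c)) `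
      {(z, b, c). 0 < z \<and> 0 < b \<and> 0 < c \<and> (b + 2 * c) * z = n}"
    (is "?A = ?f ` ?B")
proof (intro equalityI subsetI)
  fix p assume "p \<in> ?A"
  then obtain Q z c where p_eq: "p = (Q, z, c)" and "card (set_mset Q) = 1" "z \<in># Q" "0 < z" "0 < c"
    and sum: "sum_mset Q + 2 * (z * c) = n"
    by (auto simp: marked_partitions_def)
  then have Q_eq: "Q = replicate_mset (count Q z) z" and "0 < count Q z"
    by (auto simp: card_1_singleton_iff dest: set_mset_eq_singletonD)
  have "sum_mset Q = count Q z * z" by (subst Q_eq) simp
  then have "(count Q z + 2 * c) * z = n" using sum by (simp add: algebra_simps)
  then have "(z, count Q z, c) \<in> ?B" using \<open>0 < z\<close> \<open>0 < c\<close> \<open>0 < count Q z\<close> by simp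
  moreover have "p = ?f (z, count Q z, c)" using p_eq Q_eq by simp
  ultimately show "p \<in> ?f ` ?B" by (rule rev_image_eqI)
qed (auto simp: marked_partitions_def algebra_simps)

lemma card_marked_partitions_2_1_repeated:
  assumes "0 < n"
  shows "card {(Q, z, c) \<in> marked_partitions 2 1 n. z \<in># Q} = (\<Sum>d | d dvd n. (d - 1) div 2)"
proof -
  let ?B = "{(z, b, c). 0 < z \<and> 0 < b \<and> 0 < c \<and> (b + 2 * c) * z = n}"
  let ?C = "\<lambda>d::nat. {c. 0 < c \<and> 2 * c < d}"
  have C_eq: "?C d = {1..(d - 1) div 2}" for d by auto
  have "card {(Q, z, c) \<in> marked_partitions 2 1 n. z \<in># Q} = card ?B"
    unfolding marked_partitions_2_1_repeated_eq by (rule card_image) (auto simp: inj_on_def)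
  also have "card ?B = card (SIGMA d:{d. d dvd n}. ?C d)"
  proof (rule bij_betw_same_card)
    show "bij_betw (\<lambda>(z, b, c). (b + 2 * c, c)) ?B (SIGMA d:{d. d dvd n}. ?C d)"
      by (rule bij_betw_byWitness[where f' = "\<lambda>(d, c). (n div d, d - 2 * c, c)"])
        (use assms in \<open>auto elim!: dvdE\<close>)
  qed
  also have "\<dots> = (\<Sum>d | d dvd n. card (?C d))"
    using assms by (intro card_SigmaI) (auto simp: C_eq)
  finally show ?thesis by (simp add: C_eq)
qed

subsection \<open>Partitions with three part sizes\<close>

lemma even_nu_3_iff:
  assumes "n mod 4 = 2" "diagonal_form_reps 1 1 n = {}"
  shows "even (nu 3 n) \<longleftrightarrow> even (card {d. d dvd n \<and> d mod 4 = 3})"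
proof -
  let ?fresh = "\<lambda>m k. {(Q, z, c) \<in> marked_partitions m k n. z \<notin># Q}"
  let ?repeated = "\<lambda>m k. {(Q, z, c) \<in> marked_partitions m k n. z \<in># Q}"
  have "0 < n" "even n" "\<not> 4 dvd n" using assms(1) by presburger+
  have "even (card (marked_partitions 1 2 n)) \<longleftrightarrow> even (card (marked_partitions 2 1 n))"
    using even_card_marked_partitions_1_2[OF assms] even_card_marked_partitions_2_1[of n]
      card_diagonal_form_reps_4_eq_1[of 2 n] \<open>even n\<close> by simp
  moreover have "card (marked_partitions 1 2 n) = 3 * nu 3 n + card (?repeated 1 2)"
    using card_marked_partitions_split[of 1 2 n] card_marked_partitions_fresh[of 2 n]
    by (simp add: numeral_3_eq_3)
  moreover have "even (card (?repeated 1 2)) \<longleftrightarrow> even (card (?fresh 2 1))"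
    using even_card_marked_partitions_repeated[of 1 n] by (simp add: numeral_2_eq_2)
  moreover have "card (marked_partitions 2 1 n) =
      card (?fresh 2 1) + (\<Sum>d | d dvd n. (d - 1) div 2)"
    using card_marked_partitions_split[of 2 1 n] card_marked_partitions_2_1_repeated[OF \<open>0 < n\<close>]
    by simp
  ultimately show ?thesis
    unfolding even_sum_half_divisors_iff[OF \<open>\<not> 4 dvd n\<close>, symmetric] by auto
qed

lemma even_nu_3:
  fixes p m :: nat
  assumes prime_3_mod_4: "prime p" "p mod 4 = 3"
    and cofactor: "odd m" "\<not> p dvd m" "\<not> is_square m"
  shows "even (nu 3 (2 * (p * m)))"
proof -
  have "odd p" using prime_3_mod_4(2) by presburger
  then have "\<not> p dvd 2 * m" using prime_3_mod_4(1) cofactor(2)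
    by (auto simp: prime_dvd_mult_iff dest: primes_dvd_imp_eq[OF _ two_is_prime_nat])
  have "even (nu 3 (2 * (p * m))) \<longleftrightarrow> even (card {d. d dvd p * (2 * m) \<and> d mod 4 = 3})"
    unfolding mult.left_commute[of p 2 m]
  proof (rule even_nu_3_iff)
    have "odd (p * m)" using \<open>odd p\<close> \<open>odd m\<close> by simp
    then show "2 * (p * m) mod 4 = 2" by presburger
    show "diagonal_form_reps 1 1 (2 * (p * m)) = {}"
      using sum_squares_ne_prime_mult[OF prime_3_mod_4 \<open>\<not> p dvd 2 * m\<close>]
      by (auto simp: diagonal_form_reps_def mult.left_commute)
  qed
  also have "card {d. d dvd p * (2 * m) \<and> d mod 4 = 3} = card {d. d dvd 2 * m \<and> odd d}"
    using prime_3_mod_4 \<open>\<not> p dvd 2 * m\<close> by (rule card_divisors_3_mod_4)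
  also have "{d. d dvd 2 * m \<and> odd d} = {d. d dvd m}"
    using \<open>odd m\<close> by (auto simp: coprime_dvd_mult_right_iff elim: dvd_trans)
  also have "even (card {d. d dvd m}) \<longleftrightarrow> even (card {d. d\<^sup>2 = m})"
    using \<open>odd m\<close> by (intro even_card_divisors_iff) (auto intro: gr0I)
  also have "{d. d\<^sup>2 = m} = {}" using cofactor(3) by auto
  finally show ?thesis by simp
qed

lemma progression_eq_double_prime_mult:
  fixes A B n :: nat
  assumes "(A, B) \<in> {(36, 30), (72, 42), (196, 70), (252, 114)}"
  obtains p m where "A * n + B = 2 * (p * m)" "p = 3 \<or> p = 7" "odd m" "\<not> p dvd m"
    "m mod 3 = 2 \<or> m mod 4 = 3 \<or> m mod 7 = 5"
proof -
  consider (mod_36) "A = 36" "B = 30" | (mod_72) "A = 72" "B = 42"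
    | (mod_196) "A = 196" "B = 70" | (mod_252) "A = 252" "B = 114"
    using assms by auto
  then show thesis
  proof cases
    case mod_36
    moreover have "(6 * n + 5) mod 3 = 2" "\<not> 3 dvd 6 * n + 5" by presburger+
    ultimately show thesis using that[of 3 "6 * n + 5"] by simp
  next
    case mod_72
    moreover have "(12 * n + 7) mod 4 = 3" "\<not> 3 dvd 12 * n + 7" by presburger+
    ultimately show thesis using that[of 3 "12 * n + 7"] by simp
  next
    case mod_196
    moreover have "(14 * n + 5) mod 7 = 5" "\<not> 7 dvd 14 * n + 5" by presburger+
    ultimately show thesis using that[of 7 "14 * n + 5"] by simp
  next
    case mod_252
    moreover have "(42 * n + 19) mod 7 = 5" "\<not> 3 dvd 42 * n + 19" by presburger+
    ultimately show thesis using that[of 3 "42 * n + 19"] by simp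
  qed
qed

theorem theorem2:
  fixes A B n :: nat
  assumes "(A, B) \<in> {(36, 30), (72, 42), (196, 70), (252, 114)}"
  shows "[nu 3 (A * n + B) = 0] (mod 2)"
proof -
  obtain p m where eq: "A * n + B = 2 * (p * m)" and p_cases: "p = 3 \<or> p = 7"
    and cofactor: "odd m" "\<not> p dvd m" and residue: "m mod 3 = 2 \<or> m mod 4 = 3 \<or> m mod 7 = 5"
    using assms by (rule progression_eq_double_prime_mult)
  have "prime p" "p mod 4 = 3" using p_cases by auto
  moreover have "\<not> is_square m" using residue by (rule not_is_square_if_residue)
  ultimately have "even (nu 3 (2 * (p * m)))" using cofactor by (intro even_nu_3)
  then show ?thesis by (simp add: eq cong_0_iff)
qed

end
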